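(* Let $\mathscr{A}$ be a non-empty closed set of impartial games. Then either (i) $\mathcal{Q}(\mathscr{A})\cong\mathcal{T}_0$; or (ii) $\mathcal{Q}(\mathscr{A})\cong\mathcal{T}_1$; or (iii) there exists a closed subset $\mathscr{B}\subseteq\mathscr{A}$ such that $\mathcal{Q}(\mathscr{B})\cong\mathcal{T}_2$.
   Context: All games are impartial; $G+H$ is the disjunctive sum; $\ast n$ is a Nim-heap of size $n$. In misère play the last player to move loses; $o^-(G)$ is the misère outcome. A set of games is closed if it is closed under sums and under taking options; $\mathrm{cl}(\mathscr{S})$ is the smallest closed superset of $\mathscr{S}$. For closed $\mathscr{A}$, $G\equiv_{\mathscr{A}}H$ iff $o^-(G+X)=o^-(H+X)$ for all $X\in\mathscr{A}$; the misère quotient $\mathcal{Q}(\mathscr{A})=(\mathcal{Q},\mathcal{P})$ has $\mathcal{Q}=\mathscr{A}/\equiv_{\mathscr{A}}$ (a commutative monoid) and $\mathcal{P}$ the set of classes of misère $\mathscr{P}$-positions. Isomorphism $(\mathcal{Q},\mathcal{P})\cong(\mathcal{Q}',\mathcal{P}')$ means a monoid isomorphism $f$ with $x\in\mathcal{P}\iff f(x)\in\mathcal{P}'$. $\mathcal{T}_0=\mathcal{Q}(\mathrm{cl}\{0\})$ (one element, $\mathcal{P}=\emptyset$); $\mathcal{T}_1=\mathcal{Q}(\mathrm{cl}\{\ast\})\cong(\langle a\mid a^2=1\rangle,\{a\})$; $\mathcal{T}_2=\mathcal{Q}(\mathrm{cl}\{\ast 2\})\cong(\langle a,b\mid a^2=1,\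 b^3=b\rangle,\{a,b^2\})$, a commutative monoid of order 6. *)

theory Defs
  imports "HOL-Library.FSet" "HOL-Algebra.Group" "HOL.Hull"
begin

section \<open>Impartial games\<close>

text \<open>
  As usual in the theory of misere quotients, a game is finite and loop-free, and is
  identified with the set of its options; equality is therefore identity of game trees.
\<close>

datatype game = Game (options: "game fset")

definition option_rel :: "(game \<times> game) set" where
  "option_rel = {(G', G). G' |\<in>| options G}"

lemma option_rel_iff [simp]: "(G', G) \<in> option_rel \<longleftrightarrow> G' |\<in>| options G"
  by (simp add: option_rel_def)

lemma wf_option_rel: "wf option_rel"
proof (rule wfUNIVI)
  fix P :: "game \<Rightarrow> bool" and G
  assume step: "\<forall>x. (\<forall>y. (y, x) \<in> option_rel \<longrightarrow> P y) \<longrightarrow> P x"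
  show "P G"
    by (induction G) (use step in auto)
qed

lemma fimage_fundef_cong [fundef_cong]:
  "A = B \<Longrightarrow> (\<And>x. x |\<in>| B \<Longrightarrow> f x = g x) \<Longrightarrow> f |`| A = g |`| B"
  by (rule fset.map_cong) auto

text \<open>The disjunctive sum is written \<open>+\<close>, and the game without options is \<open>0\<close>.\<close>

instantiation game :: "{plus, zero}"
begin

function plus_game :: "game \<Rightarrow> game \<Rightarrow> game" where
  "plus_game G H =
     Game ((\<lambda>G'. plus_game G' H) |`| options G |\<union>| (\<lambda>H'. plus_game G H') |`| options H)"
  by pat_completeness auto
termination
  by (relation "option_rel <*lex*> option_rel") (auto intro: wf_option_rel)

definition zero_game :: game where
  "zero_game = Game {||}"

instance ..

end

declare plus_game.simps [simp del]

lemma options_plus: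
  "options (G + H) = (\<lambda>G'. G' + H) |`| options G |\<union>| (\<lambda>H'. G + H') |`| options H"
  for G H :: game
  by (subst plus_game.simps) simp

lemma options_zero [simp]: "options 0 = {||}"
  by (simp add: zero_game_def)

lemma game_option_induct [case_names options]:
  assumes "\<And>G. (\<And>G'. G' |\<in>| options G \<Longrightarrow> P G') \<Longrightarrow> P G"
  shows "P G"
  using wf_option_rel by (rule wf_induct_rule) (use assms in auto)

instance game :: comm_monoid_add
proof
  fix G H K :: game
  show "G + H = H + G"
  proof (induction G arbitrary: H rule: game_option_induct)
    case G: (options G)
    show ?case
    proof (induction H rule: game_option_induct)
      case (options H)
      have "(\<lambda>G'. G' + H) |`| game.options G = (\<lambda>G'. H + G') |`| game.options G"
        using G by (intro fset.map_cong) auto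
      moreover have "(\<lambda>H'. G + H') |`| game.options H = (\<lambda>H'. H' + G) |`| game.options H"
        using options by (intro fset.map_cong) auto
      ultimately have "game.options (G + H) = game.options (H + G)"
        by (simp add: options_plus funion_commute)
      then show ?case by (rule game.expand)
    qed
  qed
  show "0 + G = G"
    by (induction G rule: game_option_induct)
       (rule game.expand, simp add: options_plus cong: fset.map_cong)
  show "(G + H) + K = G + (H + K)"
  proof (induction G arbitrary: H K rule: game_option_induct)
    case G: (options G)
    show ?case
    proof (induction H arbitrary: K rule: game_option_induct)
      case H: (options H)
      show ?case
      proof (induction K rule: game_option_induct)
        case (options K)
        have "options ((G + H) + K) = options (G + (H + K))"
          using G H options
          by (simp add: options_plus fimage_funion fset.map_comp comp_def funion_assoc
                cong: fset.map_cong)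
        then show ?case by (rule game.expand)
      qed
    qed
  qed
qed

text \<open>The Nim-heap of size \<open>n\<close>.\<close>

function nim :: "nat \<Rightarrow> game" where
  "nim n = Game (nim |`| fset_of_list [0..<n])"
  by pat_completeness auto
termination
  by (relation "measure id") (auto simp: fset_of_list_elem)

declare nim.simps [simp del]

lemma fset_options_nim: "fset (options (nim n)) = nim ` {..<n}"
  by (subst nim.simps) (auto simp: fset_of_list.rep_eq)


section \<open>Misere play\<close>

datatype outcome = N_position | P_position

text \<open>
  The player to move wins under misere play iff either no move is available (the opponent
  made the last move and has lost) or some move leads to a position that is lost for the opponent.
\<close>

function misere_outcome :: "game \<Rightarrow> outcome" where
  "misere_outcome G =
     (if options G = {||} \<or> fBex (options G) (\<lambda>G'. misere_outcome G' = P_position)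
      then N_position else P_position)"
  by pat_completeness auto
termination
  by (relation option_rel) (auto intro: wf_option_rel)

declare misere_outcome.simps [simp del]


section \<open>Closed sets and misere quotients\<close>

definition closed_games :: "game set \<Rightarrow> bool" where
  "closed_games A \<longleftrightarrow>
     (\<forall>G\<in>A. \<forall>H\<in>A. G + H \<in> A) \<and> (\<forall>G\<in>A. \<forall>G'. G' |\<in>| options G \<longrightarrow> G' \<in> A)"

definition game_closure :: "game set \<Rightarrow> game set" where
  "game_closure S = closed_games hull S"

lemma closed_game_closure: "closed_games (game_closure S)"
  unfolding game_closure_def by (rule hull_in) (auto simp: closed_games_def)

lemma zero_in_closed_games:
  assumes "closed_games A" "A \<noteq> {}"
  shows "0 \<in> A"
proof -
  have "G \<in> A \<Longrightarrow> 0 \<in> A" for G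
  proof (induction G rule: game_option_induct)
    case (options G)
    show ?case
    proof (cases "options G = {||}")
      case True
      then have "G = 0" by (intro game.expand) simp
      with options show ?thesis by simp
    next
      case False
      then obtain G' where "G' |\<in>| game.options G" by auto
      with options assms(1) show ?thesis by (auto simp: closed_games_def)
    qed
  qed
  with assms(2) show ?thesis by auto
qed

definition indistinguishable :: "game set \<Rightarrow> (game \<times> game) set" where
  "indistinguishable A =
     {(G, H). G \<in> A \<and> H \<in> A \<and> (\<forall>X\<in>A. misere_outcome (G + X) = misere_outcome (H + X))}"

lemma equiv_indistinguishable: "equiv A (indistinguishable A)"
  by (rule equivI) (auto simp: indistinguishable_def refl_on_def sym_def trans_def)

text \<open>A bipartite monoid: a monoid with a distinguished subset.\<close>

record 'a bipartite_monoid = "'a monoid" +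
  P_part :: "'a set"

text \<open>
  The product of two classes is the class of \<open>G + H\<close> for any representatives \<open>G\<close>, \<open>H\<close>; the union
  is over a family of equal sets. For \<open>A = {}\<close> the carrier is empty, so this is a monoid
  only for non-empty closed \<open>A\<close>.
\<close>

definition misere_quotient :: "game set \<Rightarrow> game set bipartite_monoid" where
  "misere_quotient A =
     \<lparr>carrier = A // indistinguishable A,
      mult = (\<lambda>x y. \<Union>G\<in>x. \<Union>H\<in>y. indistinguishable A `` {G + H}),
      one = indistinguishable A `` {0},
      P_part = {indistinguishable A `` {G} | G. G \<in> A \<and> misere_outcome G = P_position}\<rparr>"

lemma congruent2_indistinguishable:
  assumes "closed_games A"
  shows "congruent2 (indistinguishable A) (indistinguishable A)
           (\<lambda>G H. indistinguishable A `` {G + H})"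
proof (rule congruent2I[OF equiv_indistinguishable equiv_indistinguishable])
  have *: "(G + H, G' + H) \<in> indistinguishable A"
    if "(G, G') \<in> indistinguishable A" "H \<in> A" for G G' H
    using that assms by (auto simp: indistinguishable_def closed_games_def add.assoc)
  fix G G' H
  assume "(G, G') \<in> indistinguishable A" "H \<in> A"
  note ** = *[OF this]
  show "indistinguishable A `` {G + H} = indistinguishable A `` {G' + H}"
    using ** by (rule equiv_class_eq[OF equiv_indistinguishable])
  show "indistinguishable A `` {H + G} = indistinguishable A `` {H + G'}"
    using ** by (subst (1 2) add.commute) (rule equiv_class_eq[OF equiv_indistinguishable])
qed

lemma mult_misere_quotient:
  assumes "closed_games A" "G \<in> A" "H \<in> A"
  shows "(indistinguishable A `` {G}) \<otimes>\<^bsub>misere_quotient A\<^esub> (indistinguishable A `` {H}) =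
           indistinguishable A `` {G + H}"
  using UN_equiv_class2[OF equiv_indistinguishable equiv_indistinguishable
      congruent2_indistinguishable[OF assms(1)] assms(2,3)]
  by (simp add: misere_quotient_def)

lemma comm_monoid_misere_quotient:
  assumes "closed_games A" "A \<noteq> {}"
  shows "comm_monoid (misere_quotient A)"
proof -
  note zero = zero_in_closed_games[OF assms]
  have carr: "carrier (misere_quotient A) = (\<lambda>G. indistinguishable A `` {G}) ` A"
    by (auto simp: misere_quotient_def quotient_def)
  have one: "\<one>\<^bsub>misere_quotient A\<^esub> = indistinguishable A `` {0}"
    by (simp add: misere_quotient_def)
  have sum: "G + H \<in> A" if "G \<in> A" "H \<in> A" for G H
    using that assms(1) by (auto simp: closed_games_def)
  show ?thesis
    by (rule comm_monoidI)
       (auto simp: carr one zero sum mult_misere_quotient[OF assms(1)] add_ac)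
qed

lemma class_in_P_part_iff:
  assumes "closed_games A" "A \<noteq> {}" "G \<in> A"
  shows "indistinguishable A `` {G} \<in> P_part (misere_quotient A) \<longleftrightarrow>
           misere_outcome G = P_position"
proof -
  have "misere_outcome G = misere_outcome H"
    if "(G, H) \<in> indistinguishable A" for H
    using that zero_in_closed_games[OF assms(1,2)]
    by (force simp: indistinguishable_def)
  then show ?thesis
    using assms(3) eq_equiv_class[OF _ equiv_indistinguishable, of A G]
    by (fastforce simp: misere_quotient_def)
qed

text \<open>
  A bijective homomorphism of monoids automatically preserves the identity, so
  \<^const>\<open>iso\<close> yields monoid isomorphisms.
\<close>

definition bipartite_iso ::
    "'a bipartite_monoid \<Rightarrow> 'b bipartite_monoid \<Rightarrow> bool" (infix \<open>\<cong>\<^sub>b\<close> 50) where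
  "Q \<cong>\<^sub>b Q' \<longleftrightarrow>
     (\<exists>f \<in> iso Q Q'. \<forall>x \<in> carrier Q. x \<in> P_part Q \<longleftrightarrow> f x \<in> P_part Q')"

definition T0 :: "game set bipartite_monoid" where
  "T0 = misere_quotient (game_closure {0})"

definition T1 :: "game set bipartite_monoid" where
  "T1 = misere_quotient (game_closure {nim 1})"

definition T2 :: "game set bipartite_monoid" where
  "T2 = misere_quotient (game_closure {nim 2})"

end

theory Submission
  imports Defs
begin

text \<open>
  Call a game bipartite if all its plays have the same parity of length. A bipartite game behaves
  like \<open>0\<close> or \<open>\<ast>\<close>, and is a misere P-position iff its plays are odd.
  If all games of \<open>A\<close> are bipartite, then \<open>A = {0}\<close> or the quotient is \<open>T1\<close>. Otherwise take a
  game \<open>K\<close> in \<open>A\<close> that is not bipartite although all its options are; it has options of both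
  parities and so behaves like \<open>\<ast>2\<close>. Every game in the closure of \<open>K\<close> is a sum of \<open>k\<close>
  copies of \<open>K\<close> and a bipartite game, and its outcome depends only on \<open>k\<close> and a parity, by the
  same rule as in misere Nim with \<open>k\<close> heaps of size 2 and heaps of size 1.
\<close>

section \<open>Misere outcomes and isomorphic quotients\<close>

lemma misere_P_iff:
  "misere_outcome G = P_position \<longleftrightarrow>
     options G \<noteq> {||} \<and> (\<forall>G'. G' |\<in>| options G \<longrightarrow> misere_outcome G' \<noteq> P_position)"
  by (subst misere_outcome.simps) auto

lemma misere_outcome_eqI:
  assumes "misere_outcome G = P_position \<longleftrightarrow> misere_outcome H = P_position"
  shows "misere_outcome G = misere_outcome H"
  using assms by (metis outcome.exhaust)

lemma closed_games_plus: "closed_games A \<Longrightarrow> G \<in> A \<Longrightarrow> H \<in> A \<Longrightarrow> G + H \<in> A"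
  by (simp add: closed_games_def)

lemma closed_games_option: "closed_games A \<Longrightarrow> G \<in> A \<Longrightarrow> G' |\<in>| options G \<Longrightarrow> G' \<in> A"
  by (auto simp: closed_games_def)

lemma subset_game_closure: "S \<subseteq> game_closure S"
  by (simp add: game_closure_def hull_subset)

lemma game_closure_minimal: "S \<subseteq> A \<Longrightarrow> closed_games A \<Longrightarrow> game_closure S \<subseteq> A"
  by (simp add: game_closure_def hull_minimal)

lemma carrier_misere_quotient:
  "carrier (misere_quotient A) = (\<lambda>G. indistinguishable A `` {G}) ` A"
  by (auto simp: misere_quotient_def quotient_def)

lemma bipartite_iso_refl: "Q \<cong>\<^sub>b Q"
  unfolding bipartite_iso_def by (rule bexI[of _ "\<lambda>x. x"]) (auto simp: iso_def hom_def bij_betw_def)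

text \<open>\<open>R\<close> need not be a function; it only matches games that behave alike.
  Compatibility with sums and outcomes turns a test \<open>X\<close> of \<open>G\<close> against
  \<open>G'\<close> into a test \<open>Y\<close> of \<open>H\<close> against \<open>H'\<close>, and
  totality on both sides makes the two families of tests equivalent.\<close>

lemma bipartite_iso_misere_quotientI:
  assumes A: "closed_games A" "A \<noteq> {}" and B: "closed_games B" "B \<noteq> {}"
    and left_total: "\<And>G. G \<in> A \<Longrightarrow> \<exists>H\<in>B. R G H"
    and right_total: "\<And>H. H \<in> B \<Longrightarrow> \<exists>G\<in>A. R G H"
    and plus: "\<And>G H G' H'. R G H \<Longrightarrow> R G' H' \<Longrightarrow> R (G + G') (H + H')"
    and outcome: "\<And>G H. R G H \<Longrightarrow> misere_outcome G = misere_outcome H"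
  shows "misere_quotient A \<cong>\<^sub>b misere_quotient B"
proof -
  let ?a = "\<lambda>G. indistinguishable A `` {G}" and ?b = "\<lambda>H. indistinguishable B `` {H}"
  \<comment> \<open>Read from left to right, this makes the induced map on classes well defined;
    from right to left, injective.\<close>
  have eq_iff: "?a G = ?a G' \<longleftrightarrow> ?b H = ?b H'"
    if R: "R G H" "R G' H'" and mem: "G \<in> A" "G' \<in> A" "H \<in> B" "H' \<in> B" for G G' H H'
  proof -
    have *: "misere_outcome (G + X) = misere_outcome (G' + X) \<longleftrightarrow>
        misere_outcome (H + Y) = misere_outcome (H' + Y)" if "R X Y" for X Y
      using R[THEN plus, OF that, THEN outcome] by simp
    have "(G, G') \<in> indistinguishable A \<longleftrightarrow> (H, H') \<in> indistinguishable B"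
    proof -
      have "(\<forall>X\<in>A. misere_outcome (G + X) = misere_outcome (G' + X)) \<longleftrightarrow>
          (\<forall>Y\<in>B. misere_outcome (H + Y) = misere_outcome (H' + Y))"
        using left_total right_total * by blast
      with mem show ?thesis
        by (simp add: indistinguishable_def)
    qed
    then show ?thesis
      using mem by (simp add: eq_equiv_class_iff[OF equiv_indistinguishable])
  qed
  \<comment> \<open>The map on classes goes through a chosen representative and a chosen partner; by
    \<open>eq_iff\<close> neither choice matters.\<close>
  define h where "h G = (SOME H. H \<in> B \<and> R G H)" for G
  have h: "h G \<in> B" "R G (h G)" if "G \<in> A" for G
    using someI_ex[of "\<lambda>H. H \<in> B \<and> R G H"] left_total[OF that] by (auto simp: h_def)
  define g where "g x = (SOME G. G \<in> A \<and> x = ?a G)" for x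
  have g: "g (?a G) \<in> A" "?a (g (?a G)) = ?a G" if "G \<in> A" for G
    using someI[of "\<lambda>G'. G' \<in> A \<and> ?a G = ?a G'" G] that by (auto simp: g_def)
  define f where "f x = ?b (h (g x))" for x
  have f: "f (?a G) = ?b H" if "G \<in> A" "H \<in> B" "R G H" for G H
    using eq_iff[of "g (?a G)" "h (g (?a G))" G H] g[OF that(1)] h that by (simp add: f_def)
  have fh: "f (?a G) = ?b (h G)" if "G \<in> A" for G
    using that f h by simp
  have "f \<in> iso (misere_quotient A) (misere_quotient B)"
    unfolding iso_def
  proof (intro CollectI conjI)
    show "f \<in> hom (misere_quotient A) (misere_quotient B)"
    proof (rule homI)
      fix x assume "x \<in> carrier (misere_quotient A)"
      then show "f x \<in> carrier (misere_quotient B)"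
        using fh h by (auto simp: carrier_misere_quotient)
    next
      fix x y assume "x \<in> carrier (misere_quotient A)" "y \<in> carrier (misere_quotient A)"
      then obtain G G' where "x = ?a G" "G \<in> A" "y = ?a G'" "G' \<in> A"
        by (auto simp: carrier_misere_quotient)
      then show "f (x \<otimes>\<^bsub>misere_quotient A\<^esub> y) = f x \<otimes>\<^bsub>misere_quotient B\<^esub> f y"
        using A B h plus by (simp add: mult_misere_quotient closed_games_plus
            f[of G "h G"] f[of G' "h G'"] f[of "G + G'" "h G + h G'"])
    qed
    show "bij_betw f (carrier (misere_quotient A)) (carrier (misere_quotient B))"
      unfolding bij_betw_def
    proof
      show "inj_on f (carrier (misere_quotient A))"
      proof (rule inj_onI)
        fix x y assume "x \<in> carrier (misere_quotient A)" "y \<in> carrier (misere_quotient A)"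
          and eq: "f x = f y"
        then obtain G G' where G: "x = ?a G" "G \<in> A" and G': "y = ?a G'" "G' \<in> A"
          by (auto simp: carrier_misere_quotient)
        have "?b (h G) = ?b (h G')"
          using eq G G' by (simp add: fh)
        then show "x = y"
          using eq_iff[of G "h G" G' "h G'"] G G' h by simp
      qed
      show "f ` carrier (misere_quotient A) = carrier (misere_quotient B)"
      proof
        show "f ` carrier (misere_quotient A) \<subseteq> carrier (misere_quotient B)"
          using fh h by (auto simp: carrier_misere_quotient)
        show "carrier (misere_quotient B) \<subseteq> f ` carrier (misere_quotient A)"
        proof
          fix y assume "y \<in> carrier (misere_quotient B)"
          then obtain H where H: "y = ?b H" "H \<in> B"
            by (auto simp: carrier_misere_quotient)
          with right_total obtain G where "G \<in> A" "R G H" by blast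
          with f H show "y \<in> f ` carrier (misere_quotient A)"
            by (auto simp: carrier_misere_quotient image_iff)
        qed
      qed
    qed
  qed
  moreover have "x \<in> P_part (misere_quotient A) \<longleftrightarrow> f x \<in> P_part (misere_quotient B)"
    if "x \<in> carrier (misere_quotient A)" for x
    using that h outcome[OF h(2)]
    by (auto simp: carrier_misere_quotient class_in_P_part_iff A B fh)
  ultimately show ?thesis
    unfolding bipartite_iso_def by blast
qed

section \<open>Bipartite games\<close>

text \<open>The parity is \<open>True\<close> for games all of whose plays have odd length.\<close>

inductive has_parity :: "bool \<Rightarrow> game \<Rightarrow> bool" where
  has_parityI: "(\<And>G'. G' |\<in>| options G \<Longrightarrow> has_parity (\<not> p) G') \<Longrightarrow> (p \<Longrightarrow> options G \<noteq> {||}) \<Longrightarrow>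
    has_parity p G"

lemma has_parity_option: "has_parity p G \<Longrightarrow> G' |\<in>| options G \<Longrightarrow> has_parity (\<not> p) G'"
  by (auto elim: has_parity.cases)

lemma has_parity_True_nonempty: "has_parity True G \<Longrightarrow> options G \<noteq> {||}"
  by (auto elim: has_parity.cases)

lemma has_parity_zero [simp]: "has_parity False 0"
  by (rule has_parityI) auto

text \<open>All options have the opposite parity. If \<open>p\<close> holds, there is an option and
  by induction none is a P-position. Otherwise there is no option, a win for the mover in misere
  play, or every option is a P-position.\<close>

lemma misere_outcome_has_parity:
  assumes "has_parity p G"
  shows "misere_outcome G = P_position \<longleftrightarrow> p"
  using assms
proof induction
  case (has_parityI G p)
  then show ?case
    by (cases p) (auto simp: misere_P_iff[of G])
qed

text \<open>Lengths of plays add up in a sum, and \<open>p \<noteq> q\<close> is addition of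
  parities.\<close>

lemma has_parity_plus:
  assumes "has_parity p G" "has_parity q H"
  shows "has_parity (p \<noteq> q) (G + H)"
  using assms
proof (induction G arbitrary: H p q rule: game_option_induct)
  case G: (options G)
  show ?case
    using G.prems(2)
  proof (induction H arbitrary: q rule: game_option_induct)
    case H: (options H)
    show ?case
    proof (rule has_parityI)
      fix X assume "X |\<in>| game.options (G + H)"
      then consider G' where "G' |\<in>| game.options G" "X = G' + H"
        | H' where "H' |\<in>| game.options H" "X = G + H'"
        by (auto simp: options_plus)
      then show "has_parity (\<not> (p \<noteq> q)) X"
      proof cases
        case 1
        then show ?thesis
          using G.IH[OF 1(1) has_parity_option[OF G.prems(1) 1(1)] H.prems] by simp
      next
        case 2
        then show ?thesis
          using H.IH[OF 2(1) has_parity_option[OF H.prems 2(1)]] by simp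
      qed
    next
      assume "p \<noteq> q"
      then show "game.options (G + H) \<noteq> {||}"
        using G.prems(1) H.prems
        by (cases p) (auto simp: options_plus dest: has_parity_True_nonempty)
    qed
  qed
qed

lemma closed_has_parity: "closed_games {G. \<exists>p. has_parity p G}"
  unfolding closed_games_def by (blast intro: has_parity_plus dest: has_parity_option)

text \<open>Games of equal parity are related. On each side \<open>0\<close> provides the even
  parity, and \<open>M\<close> or \<open>N\<close> the odd one.\<close>

lemma bipartite_iso_has_parity:
  assumes A: "closed_games A" "\<And>G. G \<in> A \<Longrightarrow> \<exists>p. has_parity p G" "M \<in> A" "has_parity True M"
    and B: "closed_games B" "\<And>G. G \<in> B \<Longrightarrow> \<exists>p. has_parity p G" "N \<in> B" "has_parity True N"
  shows "misere_quotient A \<cong>\<^sub>b misere_quotient B"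
proof (rule bipartite_iso_misere_quotientI)
  let ?R = "\<lambda>G H. \<exists>p. has_parity p G \<and> has_parity p H"
  have ex: "\<exists>H\<in>C. has_parity p H" if "closed_games C" "L \<in> C" "has_parity True L" for C L p
  proof -
    have "\<exists>H\<in>C. has_parity True H" "\<exists>H\<in>C. has_parity False H"
      using that zero_in_closed_games[of C] has_parity_zero by blast+
    then show ?thesis by (cases p) simp_all
  qed
  show "\<exists>H\<in>B. ?R G H" if "G \<in> A" for G
    using A(2)[OF that] ex[OF B(1,3,4)] by blast
  show "\<exists>G\<in>A. ?R G H" if "H \<in> B" for H
    using B(2)[OF that] ex[OF A(1,3,4)] by blast
  show "?R (G + G') (H + H')" if "?R G H" "?R G' H'" for G G' H H'
    using that has_parity_plus by blast
  show "misere_outcome G = misere_outcome H" if "?R G H" for G H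
    using that by (auto intro: misere_outcome_eqI simp: misere_outcome_has_parity)
qed (use A B in auto)

section \<open>Games that behave like the Nim-heap of size 2\<close>

text \<open>The pattern is that of \<open>nim 2\<close>, whose options are the even game
  \<open>0\<close> and the odd game \<open>nim 1\<close>.\<close>

definition like_nim2 :: "game \<Rightarrow> bool" where
  "like_nim2 K \<longleftrightarrow>
     (\<forall>K'. K' |\<in>| options K \<longrightarrow> (\<exists>p. has_parity p K')) \<and>
     (\<forall>p. \<exists>K'. K' |\<in>| options K \<and> has_parity p K')"

text \<open>If no option had parity \<open>p\<close>, all would have the opposite parity, and
  \<open>K\<close> would be bipartite.\<close>

lemma like_nim2I:
  assumes "\<And>K'. K' |\<in>| options K \<Longrightarrow> \<exists>p. has_parity p K'" and "\<nexists>p. has_parity p K"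
  shows "like_nim2 K"
  unfolding like_nim2_def
proof (intro conjI allI impI)
  fix p
  show "\<exists>K'. K' |\<in>| options K \<and> has_parity p K'"
  proof (rule ccontr)
    assume "\<not> ?thesis"
    then have none: "\<not> has_parity p K'" if "K' |\<in>| options K" for K'
      using that by blast
    have opp: "has_parity (\<not> p) K'" if K': "K' |\<in>| options K" for K'
    proof -
      obtain q where q: "has_parity q K'"
        using assms(1)[OF K'] by blast
      have "q \<noteq> p"
        using q none[OF K'] by (intro notI) simp
      then have "q = (\<not> p)" by simp
      with q show ?thesis by simp
    qed
    have "\<exists>r. has_parity r K"
    proof (cases "options K = {||}")
      case True
      have "has_parity False K"
        by (rule has_parityI) (use True in auto)
      then show ?thesis by blast
    next
      case False
      have "has_parity p K"
        by (rule has_parityI) (use False opp in auto)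
      then show ?thesis by blast
    qed
    then show False
      using assms(2) by blast
  qed
qed (use assms in auto)

section \<open>Sums of copies of \<open>K\<close> and a bipartite game\<close>

abbreviation copies :: "nat \<Rightarrow> game \<Rightarrow> game" where
  "copies k K \<equiv> sum_list (replicate k K)"

text \<open>It does not matter which of the equal copies is moved in. The option \<open>K'\<close>
  is grouped with \<open>X\<close> because for the intended \<open>K\<close> both are bipartite, so
  the shape of the position is kept.\<close>

lemma options_copies_plus:
  "G' |\<in>| options (copies k K + X) \<longleftrightarrow>
     (\<exists>j K'. k = Suc j \<and> K' |\<in>| options K \<and> G' = copies j K + (K' + X)) \<or>
     (\<exists>X'. X' |\<in>| options X \<and> G' = copies k K + X')"
proof (induction k arbitrary: G')
  case 0
  then show ?case by auto
next
  case (Suc k)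
  have "G' |\<in>| options (copies (Suc k) K + X) \<longleftrightarrow>
      (\<exists>K'. K' |\<in>| options K \<and> G' = K' + (copies k K + X)) \<or>
      (\<exists>G''. G'' |\<in>| options (copies k K + X) \<and> G' = K + G'')"
    by (auto simp: add.assoc options_plus[of K])
  also have "\<dots> \<longleftrightarrow> (\<exists>K'. K' |\<in>| options K \<and> G' = copies k K + (K' + X)) \<or>
      (\<exists>X'. X' |\<in>| options X \<and> G' = copies (Suc k) K + X')"
    \<comment> \<open>A move in the front copy and a move in another copy lead to the same
      positions; another copy exists only for positive \<open>k\<close>.\<close>
    unfolding Suc.IH by (cases k) (auto simp: add_ac)
  finally show ?case by auto
qed

text \<open>If \<open>like_nim2 K\<close> holds, let \<open>a\<close> be the class of the odd
  bipartite games and \<open>b\<close> that of \<open>K\<close>. Type \<open>(k, p)\<close> then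
  stands for \<open>b^k\<close>, times \<open>a\<close> if \<open>p\<close>, in the monoid presented
  by \<open>a^2 = 1\<close> and \<open>b^3 = b\<close>.\<close>

definition has_type :: "game \<Rightarrow> nat \<Rightarrow> bool \<Rightarrow> game \<Rightarrow> bool" where
  "has_type K k p G \<longleftrightarrow> (\<exists>X. has_parity p X \<and> G = copies k K + X)"

lemma has_type_plus:
  assumes "has_type K k p G" "has_type K l q H"
  shows "has_type K (k + l) (p \<noteq> q) (G + H)"
proof -
  from assms obtain X Y where "has_parity p X" "G = copies k K + X" "has_parity q Y"
    "H = copies l K + Y"
    by (auto simp: has_type_def)
  moreover from calculation have "has_parity (p \<noteq> q) (X + Y)"
    by (intro has_parity_plus)
  moreover from calculation have "G + H = copies (k + l) K + (X + Y)"
    by (simp add: replicate_add add_ac)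
  ultimately show ?thesis
    unfolding has_type_def by blast
qed

text \<open>A move in the bipartite part flips its parity; a move in a copy of \<open>K\<close>
  turns that copy into a bipartite game.\<close>

lemma has_type_option:
  assumes "like_nim2 K" "has_type K k p G" "G' |\<in>| options G"
  shows "has_type K k (\<not> p) G' \<or> (\<exists>j q. k = Suc j \<and> has_type K j q G')"
proof -
  from assms(2) obtain X where X: "has_parity p X" "G = copies k K + X"
    by (auto simp: has_type_def)
  from assms(3) consider j K' where "k = Suc j" "K' |\<in>| options K" "G' = copies j K + (K' + X)"
    | X' where "X' |\<in>| options X" "G' = copies k K + X'"
    unfolding X(2) options_copies_plus by blast
  then show ?thesis
  proof cases
    case 1
    then show ?thesis
      using assms(1) X(1) has_parity_plus unfolding like_nim2_def has_type_def by blast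
  next
    case 2
    then show ?thesis
      using X(1) has_parity_option unfolding has_type_def by blast
  qed
qed

text \<open>Since \<open>K\<close> has options of both parities, a player who moves in a copy of
  \<open>K\<close> can choose the resulting parity.\<close>

lemma has_type_option_less:
  assumes "like_nim2 K" "has_type K (Suc k) p G"
  shows "\<exists>G'. G' |\<in>| options G \<and> has_type K k q G'"
proof -
  from assms(2) obtain X where X: "has_parity p X" "G = copies (Suc k) K + X"
    by (auto simp: has_type_def)
  \<comment> \<open>This parity is the one that, added to \<open>p\<close>, gives
    \<open>q\<close>.\<close>
  from assms(1) obtain K' where K': "K' |\<in>| options K" "has_parity (p \<noteq> q) K'"
    unfolding like_nim2_def by metis
  have "copies k K + (K' + X) |\<in>| options G"
    unfolding X(2) options_copies_plus using K'(1) by blast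
  moreover have "((p \<noteq> q) \<noteq> p) = q"
    by auto
  with has_parity_plus[OF K'(2) X(1)] have "has_type K k q (copies k K + (K' + X))"
    unfolding has_type_def by auto
  ultimately show ?thesis by blast
qed

lemma has_type_option_True:
  assumes "has_type K k True G"
  shows "\<exists>G'. G' |\<in>| options G \<and> has_type K k False G'"
proof -
  from assms obtain X where X: "has_parity True X" "G = copies k K + X"
    by (auto simp: has_type_def)
  then obtain X' where X': "X' |\<in>| options X" "has_parity False X'"
    using has_parity_True_nonempty has_parity_option by fastforce
  then have "copies k K + X' |\<in>| options G"
    unfolding X(2) options_copies_plus by blast
  with X'(2) show ?thesis
    unfolding has_type_def by blast
qed

text \<open>The rule is that of misere Nim: while a heap of size 2 is left, the P-positions are
  those of Nim-sum 0; with heaps of size 1 only, their number must be odd.\<close>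

lemma misere_outcome_has_type:
  assumes "like_nim2 K" "has_type K k p G"
  shows "misere_outcome G = P_position \<longleftrightarrow> (if k = 0 then p else even k \<and> \<not> p)"
  using assms(2)
proof (induction G arbitrary: k p rule: game_option_induct)
  case (options G)
  show ?case
  proof (cases k)
    case 0
    then show ?thesis
      using options.prems misere_outcome_has_parity by (auto simp: has_type_def)
  next
    case (Suc j)
    have "misere_outcome G = P_position" if "even k" "\<not> p"
    proof -
      have "misere_outcome G' \<noteq> P_position" if G': "G' |\<in>| game.options G" for G'
        using has_type_option[OF assms(1) options.prems G']
      proof
        assume "has_type K k (\<not> p) G'"
        from options.IH[OF G' this] show ?thesis
          using \<open>\<not> p\<close> Suc by simp
      next
        assume "\<exists>i q. k = Suc i \<and> has_type K i q G'"
        then obtain q where "has_type K j q G'"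
          using Suc by auto
        \<comment> \<open>Here \<open>j\<close> is odd, hence positive, so the option is no
          P-position whatever \<open>q\<close> is.\<close>
        from options.IH[OF G' this] show ?thesis
          using \<open>even k\<close> Suc by (auto split: if_splits)
      qed
      moreover have "game.options G \<noteq> {||}"
        using has_type_option_less[OF assms(1)] options.prems Suc by blast
      ultimately show ?thesis
        unfolding misere_P_iff[of G] by blast
    qed
    moreover have "misere_outcome G \<noteq> P_position" if "odd k \<or> p"
    proof -
      have "\<exists>G'. G' |\<in>| game.options G \<and> misere_outcome G' = P_position"
      proof (cases "even k")
        case True
        \<comment> \<open>For even \<open>k\<close> the parity \<open>p\<close> is odd; a move in
          the bipartite part corrects it.\<close>
        with that options.prems obtain G' where "G' |\<in>| game.options G" "has_type K k False G'"
          using has_type_option_True[of K k G] by auto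
        with options.IH True Suc show ?thesis by auto
      next
        case False
        \<comment> \<open>The parity \<open>j = 0\<close> is where misere play shows: once the last
          copy is gone the rest must be odd, while with copies left it must be even.\<close>
        obtain G' where "G' |\<in>| game.options G" "has_type K j (j = 0) G'"
          using has_type_option_less[OF assms(1)] options.prems Suc by blast
        with options.IH False Suc show ?thesis by auto
      qed
      then show ?thesis
        unfolding misere_P_iff[of G] by blast
    qed
    ultimately show ?thesis
      using Suc by auto
  qed
qed

section \<open>The misere quotient of the closure of \<open>K\<close>\<close>

lemma game_closure_has_type:
  assumes "like_nim2 K" "G \<in> game_closure {K}"
  shows "\<exists>k p. has_type K k p G"
proof -
  have "has_type K 1 False K"
    unfolding has_type_def by (rule exI[of _ 0]) simp
  moreover have "closed_games {G. \<exists>k p. has_type K k p G}"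
    unfolding closed_games_def using has_type_plus has_type_option[OF assms(1)] by blast
  ultimately show ?thesis
    using game_closure_minimal[of "{K}" "{G. \<exists>k p. has_type K k p G}"] assms(2) by blast
qed

text \<open>The bipartite part can be taken to be an option of \<open>K\<close>, as both parities
  occur among the options and these lie in the closure.\<close>

lemma ex_has_type_game_closure:
  assumes "like_nim2 K"
  shows "\<exists>G\<in>game_closure {K}. has_type K k p G"
proof -
  note closed = closed_game_closure[of "{K}"]
  have K: "K \<in> game_closure {K}"
    using subset_game_closure by blast
  obtain X where X: "X |\<in>| options K" "has_parity p X"
    using assms unfolding like_nim2_def by blast
  have "copies k K + X \<in> game_closure {K}"
  proof (induction k)
    case 0
    show ?case
      using closed_games_option[OF closed K X(1)] by simp
  next
    case (Suc k)
    then show ?case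
      using closed_games_plus[OF closed K] by (simp add: add.assoc)
  qed
  with X(2) show ?thesis
    unfolding has_type_def by blast
qed

text \<open>Games of equal type are related: types add up, and the outcome depends on the type
  alone. With \<open>L = nim 2\<close> this identifies the quotient as \<open>T2\<close>.\<close>

lemma bipartite_iso_like_nim2:
  assumes "like_nim2 K" "like_nim2 L"
  shows "misere_quotient (game_closure {K}) \<cong>\<^sub>b misere_quotient (game_closure {L})"
proof (rule bipartite_iso_misere_quotientI)
  let ?R = "\<lambda>G H. \<exists>k p. has_type K k p G \<and> has_type L k p H"
  show "\<exists>H\<in>game_closure {L}. ?R G H" if "G \<in> game_closure {K}" for G
    using game_closure_has_type[OF assms(1) that] ex_has_type_game_closure[OF assms(2)] by blast
  show "\<exists>G\<in>game_closure {K}. ?R G H" if "H \<in> game_closure {L}" for H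
    using game_closure_has_type[OF assms(2) that] ex_has_type_game_closure[OF assms(1)] by blast
  show "?R (G + G') (H + H')" if "?R G H" "?R G' H'" for G G' H H'
    using that has_type_plus by blast
  show "misere_outcome G = misere_outcome H" if "?R G H" for G H
    using that misere_outcome_has_type[OF assms(1)] misere_outcome_has_type[OF assms(2)]
    by (intro misere_outcome_eqI) blast
qed (use subset_game_closure closed_game_closure in blast)+

section \<open>The Nim-heaps of sizes 1 and 2 as model games\<close>

lemma option_nim_iff: "G |\<in>| options (nim n) \<longleftrightarrow> (\<exists>m<n. G = nim m)"
  using fset_options_nim[of n] by auto

lemma nim_0: "nim 0 = 0"
  by (rule game.expand) (use option_nim_iff[of _ 0] in auto)

lemma has_parity_nim_1: "has_parity True (nim 1)"
proof (rule has_parityI)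
  show "options (nim 1) \<noteq> {||}"
    using option_nim_iff[of "nim 0" 1] by auto
qed (auto simp: option_nim_iff nim_0)

lemma like_nim2_nim_2: "like_nim2 (nim 2)"
proof -
  have "G |\<in>| options (nim 2) \<longleftrightarrow> G = 0 \<or> G = nim 1" for G
    by (auto simp: option_nim_iff less_2_cases_iff nim_0)
  then show ?thesis
    using has_parity_nim_1 has_parity_zero unfolding like_nim2_def by (metis (full_types))
qed

theorem theorem4p9:
  fixes A :: "game set"
  assumes "A \<noteq> {}" and "closed_games A"
  shows "misere_quotient A \<cong>\<^sub>b T0 \<or>
         misere_quotient A \<cong>\<^sub>b T1 \<or>
         (\<exists>B. B \<subseteq> A \<and> closed_games B \<and> misere_quotient B \<cong>\<^sub>b T2)"
proof (cases "\<forall>G\<in>A. \<exists>p. has_parity p G")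
  case parity: True
  show ?thesis
  proof (cases "\<exists>G\<in>A. has_parity True G")
    case True
    have "\<exists>p. has_parity p G" if "G \<in> game_closure {nim 1}" for G
      using game_closure_minimal[OF _ closed_has_parity, of "{nim 1}"] has_parity_nim_1 that by blast
    with True parity assms(2) have "misere_quotient A \<cong>\<^sub>b T1"
      unfolding T1_def using bipartite_iso_has_parity closed_game_closure subset_game_closure
        has_parity_nim_1 by (metis insert_subset)
    then show ?thesis by blast
  next
    case False
    \<comment> \<open>Any option of an even game in \<open>A\<close> would be an odd game in
      \<open>A\<close>, so there are no options at all.\<close>
    have "G = 0" if "G \<in> A" for G
    proof -
      have "has_parity False G"
        using that parity False by (metis (full_types))
      then have "options G = {||}"
        using that False has_parity_option[of False G] closed_games_option[OF assms(2)] by auto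
      then show ?thesis by (intro game.expand) simp
    qed
    with assms have A: "A = {0}" by auto
    with assms(2) have "game_closure {0} = A"
      unfolding game_closure_def by (simp add: hull_same)
    then show ?thesis
      by (simp add: T0_def bipartite_iso_refl)
  qed
next
  case False
  then obtain K\<^sub>0 where "K\<^sub>0 \<in> {G \<in> A. \<nexists>p. has_parity p G}" by blast
  \<comment> \<open>\<open>K\<close> is minimal among the non-bipartite games of \<open>A\<close>.
    Its options lie in \<open>A\<close> by closedness, so they are bipartite.\<close>
  then obtain K where K: "K \<in> {G \<in> A. \<nexists>p. has_parity p G}"
    and min: "\<And>K'. (K', K) \<in> option_rel \<Longrightarrow> K' \<notin> {G \<in> A. \<nexists>p. has_parity p G}"
    by (rule wfE_min[OF wf_option_rel]) (rule that)
  have "\<exists>p. has_parity p K'" if "K' |\<in>| options K" for K'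
    using K min[of K'] closed_games_option[OF assms(2) _ that] that by simp
  with K have "like_nim2 K"
    by (simp add: like_nim2I)
  then have "misere_quotient (game_closure {K}) \<cong>\<^sub>b T2"
    unfolding T2_def by (rule bipartite_iso_like_nim2[OF _ like_nim2_nim_2])
  moreover have "game_closure {K} \<subseteq> A"
    using K assms(2) by (intro game_closure_minimal) auto
  ultimately show ?thesis
    using closed_game_closure[of "{K}"] by blast
qed

end
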